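(* Let $\Theta_*=\{\boldsymbol{\theta}=(\sigma,\alpha,\rho)^\top\in(0,\infty)\times(0,\infty)\times[0,1] : \alpha\in\mathbb{N}\ \text{and}\ \rho<1\}$. Then the mapping $\boldsymbol{\theta}\mapsto F_W(\cdot\,;\boldsymbol{\theta})$ is one-to-one on $\Theta_*$; that is, if $\boldsymbol{\theta}_1,\boldsymbol{\theta}_2\in\Theta_*$ satisfy $F_W(w;\boldsymbol{\theta}_1)=F_W(w;\boldsymbol{\theta}_2)$ for all $0<w<1$, then $\boldsymbol{\theta}_1=\boldsymbol{\theta}_2$.
   Context: For $\boldsymbol{\theta}=(\sigma,\alpha,\rho)^\top$ with $\sigma>0$, $\alpha>0$, $0\leqslant\rho\leqslant1$, the cumulative distribution function (CDF) of the unit-Fréchet distribution ${\rm UF}(\boldsymbol{\theta})$ on $(0,1)$ is, for $0<w<1$, $$F_W(w;\boldsymbol{\theta})=\frac{\frac{s^\alpha}{\sigma^\alpha}}{\frac{s^\alpha}{\sigma^\alpha}+1}\cdot\frac{\left(\frac{s^\alpha}{\sigma^\alpha}+1\right)^2-\rho}{\left(\frac{s^\alpha}{\sigma^\alpha}+1\right)^2-\rho\,\frac{s^\alpha}{\sigma^\alpha}},\qquad s=\frac{w}{1-w}.$$ Here $\mathbb{N}$ denotes the positive integers. *)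

theory Defs
  imports Complex_Main "HOL-Library.FuncSet"
begin

text \<open>Parameter vectors are triples (sigma, alpha, rho). The formula is the CDF of the
  unit-Frechet distribution only for 0 < w < 1; other arguments carry no meaning. Since alpha is
  a positive real, powers are written with powr, whose base is positive for 0 < w < 1.\<close>

definition unit_frechet_cdf :: "real \<times> real \<times> real \<Rightarrow> real \<Rightarrow> real" where
  "unit_frechet_cdf = (\<lambda>(\<sigma>, \<alpha>, \<rho>) w.
     let s = w / (1 - w); x = s powr \<alpha> / \<sigma> powr \<alpha>
     in x / (x + 1) * (((x + 1)\<^sup>2 - \<rho>) / ((x + 1)\<^sup>2 - \<rho> * x)))"

definition Theta_star :: "(real \<times> real \<times> real) set" where
  "Theta_star = {(\<sigma>, \<alpha>, \<rho>). (\<sigma>, \<alpha>, \<rho>) \<in> {0<..} \<times> {0<..} \<times> {0..1} \<and> \<alpha> \<in> \<nat> \<and> \<rho> < 1}"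

end

theory Submission
  imports Defs
begin

text \<open>In terms of \<open>x = (s / \<sigma>) powr \<alpha>\<close> the CDF is a function \<open>G\<^sub>\<rho>(x)\<close> with
  \<open>G\<^sub>\<rho>(x) \<sim> (1 - \<rho>) x\<close> as \<open>x \<rightarrow> 0\<close>, so the behaviour at \<open>s \<rightarrow> 0\<close> determines \<open>\<alpha>\<close> and
  \<open>(1 - \<rho>) / \<sigma> powr \<alpha>\<close>. The symmetry \<open>G\<^sub>\<rho>(1 / x) = 1 - G\<^sub>\<rho>(x)\<close> turns the behaviour at
  \<open>s \<rightarrow> \<infinity>\<close> into the same statement with \<open>\<sigma>\<close> inverted, which determines
  \<open>(1 - \<rho>) * \<sigma> powr \<alpha>\<close>. The two products give \<open>\<rho>\<close> and \<open>\<sigma>\<close>.\<close>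

definition cdf_profile :: "real \<Rightarrow> real \<Rightarrow> real" where
  "cdf_profile \<rho> x = x / (x + 1) * (((x + 1)\<^sup>2 - \<rho>) / ((x + 1)\<^sup>2 - \<rho> * x))"

text \<open>Since w = s / (1 + s) inverts s = w / (1 - w) and maps the positive reals onto (0,1),
  equality of two CDFs on (0,1) becomes equality of profiles for every s > 0.\<close>

lemma unit_frechet_cdf_eq:
  assumes "s > 0"
  shows "unit_frechet_cdf (\<sigma>, \<alpha>, \<rho>) (s / (1 + s)) = cdf_profile \<rho> (s powr \<alpha> / \<sigma> powr \<alpha>)"
proof -
  have "s / (1 + s) / (1 - s / (1 + s)) = s"
    using assms by (simp add: field_simps)
  then show ?thesis
    by (simp add: unit_frechet_cdf_def cdf_profile_def Let_def)
qed

text \<open>Over the common denominator \<open>(x + 1) * ((x + 1)\<^sup>2 - \<rho> * x)\<close> both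
  sides have numerator \<open>(x + 1)\<^sup>2 - \<rho> * x\<^sup>2\<close>.\<close>

lemma cdf_profile_inverse:
  assumes "x > 0" "\<rho> < 1"
  shows "cdf_profile \<rho> (1 / x) = 1 - cdf_profile \<rho> x"
proof -
  have "\<rho> * x < x"
    using assms by simp
  \<comment> \<open>The left-hand side exceeds x^2 + x + 1.\<close>
  then have D: "(x + 1)\<^sup>2 - \<rho> * x > 0"
    using assms(1) zero_le_square[of x] unfolding power2_eq_square distrib_left distrib_right by linarith
  have "1 / x / (1 / x + 1) = 1 / (x + 1)"
    using assms by (simp add: field_simps)
  moreover have "(1 / x + 1)\<^sup>2 - \<rho> = ((x + 1)\<^sup>2 - \<rho> * x\<^sup>2) / x\<^sup>2"
    "(1 / x + 1)\<^sup>2 - \<rho> * (1 / x) = ((x + 1)\<^sup>2 - \<rho> * x) / x\<^sup>2"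
    using assms by (simp_all add: field_simps power2_eq_square)
  ultimately have "cdf_profile \<rho> (1 / x) = ((x + 1)\<^sup>2 - \<rho> * x\<^sup>2) / ((x + 1) * ((x + 1)\<^sup>2 - \<rho> * x))"
    using assms by (simp add: cdf_profile_def)
  moreover have "1 - cdf_profile \<rho> x =
      ((x + 1) * ((x + 1)\<^sup>2 - \<rho> * x) - x * ((x + 1)\<^sup>2 - \<rho>)) / ((x + 1) * ((x + 1)\<^sup>2 - \<rho> * x))"
    using assms D unfolding cdf_profile_def times_divide_times_eq
    by (subst diff_divide_distrib) auto
  moreover have "(x + 1) * ((x + 1)\<^sup>2 - \<rho> * x) - x * ((x + 1)\<^sup>2 - \<rho>) = (x + 1)\<^sup>2 - \<rho> * x\<^sup>2"
    by (simp add: power2_eq_square algebra_simps)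
  ultimately show ?thesis
    by simp
qed

lemma powr_tendsto_0_at_right:
  fixes \<beta> :: real
  assumes "\<beta> > 0"
  shows "((\<lambda>s. s powr \<beta>) \<longlongrightarrow> 0) (at_right 0)"
proof -
  \<comment> \<open>The base tends to 0, so \<open>tendsto_powr'\<close> asks for a positive
    exponent and an eventually nonnegative base; \<open>0 powr \<beta>\<close> evaluates to
    0.\<close>
  have "((\<lambda>s::real. s powr \<beta>) \<longlongrightarrow> 0 powr \<beta>) (at_right 0)"
    using assms by (intro tendsto_powr' tendsto_ident_at tendsto_const)
      (auto simp: eventually_at_right_less intro: eventually_mono[OF eventually_at_right_less])
  then show ?thesis
    by simp
qed

text \<open>Dividing by \<open>s powr \<alpha>\<close> cancels the vanishing factor of the profile;
  in what remains both denominators tend to 1. Leaving \<open>a\<close> arbitrary covers both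
  \<open>1 / \<sigma> powr \<alpha>\<close> and \<open>\<sigma> powr \<alpha>\<close>.\<close>

lemma cdf_profile_powr_asymp:
  assumes "\<alpha> > 0"
  shows "((\<lambda>s. cdf_profile \<rho> (a * s powr \<alpha>) / s powr \<alpha>) \<longlongrightarrow> a * (1 - \<rho>)) (at_right 0)"
proof -
  let ?x = "\<lambda>s. a * s powr \<alpha>"
  have x: "(?x \<longlongrightarrow> 0) (at_right 0)"
    using tendsto_mult_left[OF powr_tendsto_0_at_right[OF assms], of a] by simp
  have "((\<lambda>s. a / (?x s + 1) * (((?x s + 1)\<^sup>2 - \<rho>) / ((?x s + 1)\<^sup>2 - \<rho> * ?x s))) \<longlongrightarrow>
      a / (0 + 1) * (((0 + 1)\<^sup>2 - \<rho>) / ((0 + 1)\<^sup>2 - \<rho> * 0))) (at_right 0)"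
    by (intro tendsto_intros x) auto
  moreover have "\<forall>\<^sub>F s in at_right 0. a / (?x s + 1) * (((?x s + 1)\<^sup>2 - \<rho>) / ((?x s + 1)\<^sup>2 - \<rho> * ?x s))
      = cdf_profile \<rho> (?x s) / s powr \<alpha>"
    using eventually_at_right_less[of "0::real"]
    by eventually_elim (simp add: cdf_profile_def)
  ultimately show ?thesis
    by (simp add: tendsto_cong)
qed

text \<open>If \<alpha> were larger on the right, the common function would be
  o(\<open>s powr \<alpha>\<^sub>1\<close>) at 0, contradicting its nonzero leading coefficient
  \<open>a\<^sub>1 * (1 - \<rho>\<^sub>1)\<close>.\<close>

lemma cdf_profile_powr_le:
  assumes "\<alpha>\<^sub>1 > 0" "\<alpha>\<^sub>2 > 0" "a\<^sub>1 \<noteq> 0" "\<rho>\<^sub>1 \<noteq> 1"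
    and eq: "\<And>s. s > 0 \<Longrightarrow> cdf_profile \<rho>\<^sub>1 (a\<^sub>1 * s powr \<alpha>\<^sub>1) = cdf_profile \<rho>\<^sub>2 (a\<^sub>2 * s powr \<alpha>\<^sub>2)"
  shows "\<alpha>\<^sub>2 \<le> \<alpha>\<^sub>1"
proof (rule ccontr)
  assume "\<not> \<alpha>\<^sub>2 \<le> \<alpha>\<^sub>1"
  then have "((\<lambda>s. cdf_profile \<rho>\<^sub>2 (a\<^sub>2 * s powr \<alpha>\<^sub>2) / s powr \<alpha>\<^sub>2 * s powr (\<alpha>\<^sub>2 - \<alpha>\<^sub>1))
      \<longlongrightarrow> a\<^sub>2 * (1 - \<rho>\<^sub>2) * 0) (at_right 0)"
    using assms by (intro tendsto_mult cdf_profile_powr_asymp powr_tendsto_0_at_right) auto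
  moreover have "\<forall>\<^sub>F s in at_right 0. cdf_profile \<rho>\<^sub>2 (a\<^sub>2 * s powr \<alpha>\<^sub>2) / s powr \<alpha>\<^sub>2 * s powr (\<alpha>\<^sub>2 - \<alpha>\<^sub>1)
      = cdf_profile \<rho>\<^sub>1 (a\<^sub>1 * s powr \<alpha>\<^sub>1) / s powr \<alpha>\<^sub>1"
    using eventually_at_right_less[of "0::real"]
    by eventually_elim (simp add: eq powr_diff)
  ultimately have "((\<lambda>s. cdf_profile \<rho>\<^sub>1 (a\<^sub>1 * s powr \<alpha>\<^sub>1) / s powr \<alpha>\<^sub>1) \<longlongrightarrow> 0) (at_right 0)"
    by (simp add: tendsto_cong)
  from tendsto_unique[OF _ this cdf_profile_powr_asymp] assms show False
    by (simp add: trivial_limit_at_right_real)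
qed

lemma cdf_profile_powr_leading_coeff:
  assumes "\<alpha> > 0"
    and eq: "\<And>s. s > 0 \<Longrightarrow> cdf_profile \<rho>\<^sub>1 (a\<^sub>1 * s powr \<alpha>) = cdf_profile \<rho>\<^sub>2 (a\<^sub>2 * s powr \<alpha>)"
  shows "a\<^sub>1 * (1 - \<rho>\<^sub>1) = a\<^sub>2 * (1 - \<rho>\<^sub>2)"
proof -
  have "\<forall>\<^sub>F s in at_right 0. cdf_profile \<rho>\<^sub>2 (a\<^sub>2 * s powr \<alpha>) / s powr \<alpha>
      = cdf_profile \<rho>\<^sub>1 (a\<^sub>1 * s powr \<alpha>) / s powr \<alpha>"
    using eventually_at_right_less[of "0::real"]
    by eventually_elim (simp add: eq)
  then have "((\<lambda>s. cdf_profile \<rho>\<^sub>1 (a\<^sub>1 * s powr \<alpha>) / s powr \<alpha>) \<longlongrightarrow> a\<^sub>2 * (1 - \<rho>\<^sub>2)) (at_right 0)"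
    using cdf_profile_powr_asymp[OF assms(1)] by (rule Lim_transform_eventually[rotated])
  from tendsto_unique[OF _ cdf_profile_powr_asymp[OF assms(1)] this] show ?thesis
    by (simp add: trivial_limit_at_right_real)
qed

theorem theorem4p1:
  shows "inj_on (\<lambda>\<theta>. \<lambda>w\<in>{0<..<1}. unit_frechet_cdf \<theta> w) Theta_star"
proof (rule inj_onI, simp only: split_paired_all)
  fix \<sigma>\<^sub>1 \<alpha>\<^sub>1 \<rho>\<^sub>1 \<sigma>\<^sub>2 \<alpha>\<^sub>2 \<rho>\<^sub>2 :: real
  assume "(\<sigma>\<^sub>1, \<alpha>\<^sub>1, \<rho>\<^sub>1) \<in> Theta_star" "(\<sigma>\<^sub>2, \<alpha>\<^sub>2, \<rho>\<^sub>2) \<in> Theta_star"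
  then have pos: "\<sigma>\<^sub>1 > 0" "\<alpha>\<^sub>1 > 0" "\<rho>\<^sub>1 < 1" "\<sigma>\<^sub>2 > 0" "\<alpha>\<^sub>2 > 0" "\<rho>\<^sub>2 < 1"
    by (auto simp: Theta_star_def)
  assume eq: "(\<lambda>w\<in>{0<..<1}. unit_frechet_cdf (\<sigma>\<^sub>1, \<alpha>\<^sub>1, \<rho>\<^sub>1) w) =
    (\<lambda>w\<in>{0<..<1}. unit_frechet_cdf (\<sigma>\<^sub>2, \<alpha>\<^sub>2, \<rho>\<^sub>2) w)"
  define c\<^sub>1 c\<^sub>2 where "c\<^sub>1 = \<sigma>\<^sub>1 powr \<alpha>\<^sub>1" and "c\<^sub>2 = \<sigma>\<^sub>2 powr \<alpha>\<^sub>2"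
  have c: "c\<^sub>1 > 0" "c\<^sub>2 > 0"
    using pos by (simp_all add: c\<^sub>1_def c\<^sub>2_def)
  have near_0: "cdf_profile \<rho>\<^sub>1 (1 / c\<^sub>1 * s powr \<alpha>\<^sub>1) = cdf_profile \<rho>\<^sub>2 (1 / c\<^sub>2 * s powr \<alpha>\<^sub>2)"
    if "s > 0" for s
    using fun_cong[OF eq, of "s / (1 + s)"] that by (simp add: unit_frechet_cdf_eq c\<^sub>1_def c\<^sub>2_def)
  \<comment> \<open>At \<open>1 / s\<close> the arguments in \<open>near_0\<close> are the
    reciprocals of those here, so the symmetry turns each side into 1 minus the profile
    wanted.\<close>
  have near_infinity: "cdf_profile \<rho>\<^sub>1 (c\<^sub>1 * s powr \<alpha>\<^sub>1) = cdf_profile \<rho>\<^sub>2 (c\<^sub>2 * s powr \<alpha>\<^sub>2)"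
    if "s > 0" for s
    using near_0[of "1 / s"] that c pos
      cdf_profile_inverse[of "c\<^sub>1 * s powr \<alpha>\<^sub>1" \<rho>\<^sub>1] cdf_profile_inverse[of "c\<^sub>2 * s powr \<alpha>\<^sub>2" \<rho>\<^sub>2]
    by (simp add: powr_divide)
  have \<alpha>: "\<alpha>\<^sub>1 = \<alpha>\<^sub>2"
  proof (rule antisym)
    show "\<alpha>\<^sub>1 \<le> \<alpha>\<^sub>2"
      using cdf_profile_powr_le[of \<alpha>\<^sub>2 \<alpha>\<^sub>1 c\<^sub>2 \<rho>\<^sub>2 \<rho>\<^sub>1 c\<^sub>1] near_infinity pos c by simp
    show "\<alpha>\<^sub>2 \<le> \<alpha>\<^sub>1"
      using cdf_profile_powr_le[of \<alpha>\<^sub>1 \<alpha>\<^sub>2 c\<^sub>1 \<rho>\<^sub>1 \<rho>\<^sub>2 c\<^sub>2] near_infinity pos c by simp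
  qed
  have at_infinity: "c\<^sub>1 * (1 - \<rho>\<^sub>1) = c\<^sub>2 * (1 - \<rho>\<^sub>2)"
    by (rule cdf_profile_powr_leading_coeff[OF \<open>\<alpha>\<^sub>1 > 0\<close>]) (use near_infinity \<alpha> in simp)
  have at_0: "1 / c\<^sub>1 * (1 - \<rho>\<^sub>1) = 1 / c\<^sub>2 * (1 - \<rho>\<^sub>2)"
    by (rule cdf_profile_powr_leading_coeff[OF \<open>\<alpha>\<^sub>1 > 0\<close>]) (use near_0 \<alpha> in simp)
  \<comment> \<open>Multiplying the two coefficients cancels the scale \<open>c\<^sub>1\<close> and
    isolates \<rho>.\<close>
  have "(1 - \<rho>\<^sub>1)\<^sup>2 = (c\<^sub>1 * (1 - \<rho>\<^sub>1)) * (1 / c\<^sub>1 * (1 - \<rho>\<^sub>1))"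
    using c by (simp add: power2_eq_square)
  also have "\<dots> = (1 - \<rho>\<^sub>2)\<^sup>2"
    unfolding at_infinity at_0 using c by (simp add: power2_eq_square)
  \<comment> \<open>Both 1 - \<rho> are positive, which rules out the opposite sign of the
    root.\<close>
  finally have \<rho>: "\<rho>\<^sub>1 = \<rho>\<^sub>2"
    using pos by (simp add: power2_eq_iff)
  then have "\<sigma>\<^sub>1 powr \<alpha>\<^sub>1 = \<sigma>\<^sub>2 powr \<alpha>\<^sub>1"
    using at_infinity pos \<alpha> by (simp add: c\<^sub>1_def c\<^sub>2_def)
  \<comment> \<open>A power with positive exponent is strictly increasing in its base.\<close>
  then have "\<sigma>\<^sub>1 = \<sigma>\<^sub>2"
    using pos powr_less_mono2[of \<alpha>\<^sub>1 \<sigma>\<^sub>1 \<sigma>\<^sub>2] powr_less_mono2[of \<alpha>\<^sub>1 \<sigma>\<^sub>2 \<sigma>\<^sub>1]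
    by (metis less_irrefl linorder_neqE_linordered_idom less_imp_le)
  with \<alpha> \<rho> show "(\<sigma>\<^sub>1, \<alpha>\<^sub>1, \<rho>\<^sub>1) = (\<sigma>\<^sub>2, \<alpha>\<^sub>2, \<rho>\<^sub>2)"
    by simp
qed

end
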